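(* Let $m,n$ be positive integers, let $K$ be an arbitrary field, and let $c=\gcd(m+1,n+1)-1$. For the $m\times n$ rectangular graph $G$ with black-to-white adjacency map $BW_K$ and white-to-black adjacency map $\mathit{WB}_K$ over $K$, we have $$\dim_K \ker BW_K=\lceil c/2\rceil,\qquad \dim_K\ker \mathit{WB}_K=\lfloor c/2\rfloor .$$ Moreover, each of these two kernels has a basis consisting of vectors all of whose coordinates belong to $\{0,1,-1\}$.
   Context: The $m\times n$ rectangular graph is $G=\{(x,y)\in\mathbb{Z}^2: 0\le x\le m-1,\ 0\le y\le n-1\}$, where two points are adjacent iff they differ by exactly $1$ in exactly one coordinate. A point $(x,y)$ is black if $x+y$ is even and white if $x+y$ is odd (so the origin is black). Let $K^{\mathrm{black}}$ (resp. $K^{\mathrm{white}}$) be the space of $K$-valued functions on the black (resp. white) points of $G$. The black-to-white adjacency map $BW_K:K^{\mathrm{black}}\to K^{\mathrm{white}}$ is $(BW_K v)(w)=\sum v(b)$, the sum over the black points $b$ adjacent to $w$; i.e. its matrix (rows indexed by white points, columns by black points) has entry $1$ if the points are adjacent and $0$ otherwise. The white-to-black adjacency map $\mathit{WB}_K:K^{\mathrm{white}}\to K^{\mathrm{black}}$ is defined analogously. *)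

theory Defs
  imports Complex_Main "HOL-Library.Function_Algebras"
begin

definition fun_scale :: "'k::field \<Rightarrow> ('a \<Rightarrow> 'k) \<Rightarrow> 'a \<Rightarrow> 'k" where
  "fun_scale a v = (\<lambda>p. a * v p)"

global_interpretation fun_vs: vector_space "fun_scale :: 'k::field \<Rightarrow> ('a \<Rightarrow> 'k) \<Rightarrow> 'a \<Rightarrow> 'k"
  by unfold_locales (auto simp: fun_scale_def fun_eq_iff algebra_simps)

(* The space of functions S -> K, encoded as the functions on the whole type that vanish off S. *)
definition functions_on :: "'a set \<Rightarrow> ('a \<Rightarrow> 'k::field) set" where
  "functions_on S = {v. \<forall>p. p \<notin> S \<longrightarrow> v p = 0}"

definition rect_points :: "nat \<Rightarrow> nat \<Rightarrow> (int \<times> int) set" where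
  "rect_points m n = {(x, y). 0 \<le> x \<and> x \<le> int m - 1 \<and> 0 \<le> y \<and> y \<le> int n - 1}"

definition adjacent :: "int \<times> int \<Rightarrow> int \<times> int \<Rightarrow> bool" where
  "adjacent p q \<longleftrightarrow>
     (\<bar>fst p - fst q\<bar> = 1 \<and> snd p = snd q) \<or> (fst p = fst q \<and> \<bar>snd p - snd q\<bar> = 1)"

definition black :: "nat \<Rightarrow> nat \<Rightarrow> (int \<times> int) set" where
  "black m n = {p \<in> rect_points m n. even (fst p + snd p)}"

definition white :: "nat \<Rightarrow> nat \<Rightarrow> (int \<times> int) set" where
  "white m n = {p \<in> rect_points m n. odd (fst p + snd p)}"

definition BW :: "nat \<Rightarrow> nat \<Rightarrow> (int \<times> int \<Rightarrow> 'k::field) \<Rightarrow> int \<times> int \<Rightarrow> 'k" where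
  "BW m n v = (\<lambda>w. if w \<in> white m n then \<Sum>b\<in>{b \<in> black m n. adjacent b w}. v b else 0)"

definition WB :: "nat \<Rightarrow> nat \<Rightarrow> (int \<times> int \<Rightarrow> 'k::field) \<Rightarrow> int \<times> int \<Rightarrow> 'k" where
  "WB m n v = (\<lambda>b. if b \<in> black m n then \<Sum>w\<in>{w \<in> white m n. adjacent w b}. v w else 0)"

definition ker_BW :: "nat \<Rightarrow> nat \<Rightarrow> (int \<times> int \<Rightarrow> 'k::field) set" where
  "ker_BW m n = {v \<in> functions_on (black m n). BW m n v = 0}"

definition ker_WB :: "nat \<Rightarrow> nat \<Rightarrow> (int \<times> int \<Rightarrow> 'k::field) set" where
  "ker_WB m n = {v \<in> functions_on (white m n). WB m n v = 0}"

lemma subspace_functions_on: "fun_vs.subspace (functions_on S)"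
  by (auto simp: fun_vs.subspace_def functions_on_def fun_scale_def)

lemma finite_rect_points: "finite (rect_points m n)"
proof (rule finite_subset)
  show "rect_points m n \<subseteq> {0..int m - 1} \<times> {0..int n - 1}"
    by (auto simp: rect_points_def)
qed simp

lemma functions_on_subset_span:
  assumes "finite S"
  shows "functions_on S \<subseteq> fun_vs.span ((\<lambda>p q. if q = p then 1 else (0::'k::field)) ` S)"
proof
  fix v :: "'a \<Rightarrow> 'k" assume v: "v \<in> functions_on S"
  have sum_fun: "(\<Sum>p\<in>A. f p) q = (\<Sum>p\<in>A. f p q)" if "finite A"
    for A and f :: "'a \<Rightarrow> 'a \<Rightarrow> 'k" and q
    using that by (induction A rule: finite_induct) auto
  have "v = (\<Sum>p\<in>S. fun_scale (v p) (\<lambda>q. if q = p then 1 else 0))"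
    using v assms by (auto simp: fun_eq_iff sum_fun fun_scale_def functions_on_def if_distrib
        cong: if_cong)
  also have "\<dots> \<in> fun_vs.span ((\<lambda>p q. if q = p then 1 else 0) ` S)"
    by (intro fun_vs.span_sum fun_vs.span_scale fun_vs.span_base) auto
  finally show "v \<in> fun_vs.span ((\<lambda>p q. if q = p then 1 else 0) ` S)" .
qed

lemma linear_BW: "Vector_Spaces.linear fun_scale fun_scale (BW m n)"
  by unfold_locales
    (auto simp: BW_def fun_scale_def fun_eq_iff algebra_simps sum.distrib sum_distrib_left)

lemma linear_WB: "Vector_Spaces.linear fun_scale fun_scale (WB m n)"
  by unfold_locales
    (auto simp: WB_def fun_scale_def fun_eq_iff algebra_simps sum.distrib sum_distrib_left)

lemma BW_in_functions_on: "BW m n v \<in> functions_on (white m n)"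
  by (simp add: BW_def functions_on_def)

lemma WB_in_functions_on: "WB m n v \<in> functions_on (black m n)"
  by (simp add: WB_def functions_on_def)

end

theory Submission
  imports Defs "HOL-Number_Theory.Cong"
begin

text \<open>
  Shift the rectangle to \<open>1 \<le> x \<le> m\<close>, \<open>1 \<le> y \<le> n\<close>, put \<open>M = m + 1\<close>, \<open>N = n + 1\<close>, \<open>d = gcd M N\<close>.
  The operator \<open>X + X\<inverse> + Y + Y\<inverse> = (X + Y) (1 + X\<inverse> Y\<inverse>)\<close> factors, so, as for the wave equation,
  \<open>(-1)\<^sup>y (F (x + y) - F (x - y))\<close> is in its kernel for every \<open>F\<close>, and it vanishes on the boundary if
  \<open>F\<close> is even and \<open>2d\<close>-periodic.  The indicator functions of \<open>\<plusminus>a\<close> modulo \<open>2d\<close>, for \<open>2 \<le> a \<le> d\<close>,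
  give the basis; the parity of \<open>a\<close> is the colour of the support.

  Conversely, extend a kernel element to an odd \<open>2M\<close>-periodic function of \<open>x\<close> and let \<open>f\<close> be its
  row \<open>y = 1\<close>.  Integrating the two factors in turn shows \<open>f (x + N) = f (x - N)\<close> and
  \<open>f N = 0\<close>.  Hence \<open>f\<close> is odd and \<open>2d\<close>-periodic; since \<open>f M = f N = 0\<close> and one of \<open>M/d\<close>, \<open>N/d\<close> is
  odd, also \<open>f d = 0\<close>, in every characteristic.  So \<open>f\<close>, and with it the kernel element, is
  determined by \<open>f 1, \<dots>, f (d - 1)\<close>.
\<close>

section \<open>Uniqueness\<close>

text \<open>By the wave equation, \<open>E (x + 1) y + E x (Suc y)\<close> only changes sign when
  \<open>x\<close> and \<open>y\<close> both grow by 1. Following this diagonal down to row 0, where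
  \<open>E\<close> vanishes, leaves one entry of row 1.\<close>

lemma wave_step_left:
  fixes E :: "int \<Rightarrow> nat \<Rightarrow> 'k::field"
  assumes wave: "\<And>x y. Suc y < N \<Longrightarrow> E (x + 1) (Suc y) + E (x - 1) (Suc y) + E x (Suc (Suc y)) + E x y = 0"
    and bottom: "\<And>x. E x 0 = 0"
    and "y < N"
  shows "E (x + 1) y + E x (Suc y) = (-1) ^ y * E (x - int y) 1"
  using \<open>y < N\<close>
proof (induction y arbitrary: x)
  case 0
  then show ?case by (simp add: bottom)
next
  case (Suc y)
  have "E (x + 1) (Suc y) + E x (Suc (Suc y)) = - (E (x - 1 + 1) y + E (x - 1) (Suc y))"
    using wave[OF Suc.prems, of x] by (simp only: eq_neg_iff_add_eq_0) (simp add: add_ac)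
  also have "\<dots> = (-1) ^ Suc y * E (x - int (Suc y)) 1"
    using Suc.prems by (subst Suc.IH) (simp_all add: algebra_simps)
  finally show ?case .
qed

text \<open>Reflecting \<open>x\<close> to \<open>-x\<close> preserves the wave equation and
  exchanges the two diagonal directions.\<close>

lemma wave_step_right:
  fixes E :: "int \<Rightarrow> nat \<Rightarrow> 'k::field"
  assumes wave: "\<And>x y. Suc y < N \<Longrightarrow> E (x + 1) (Suc y) + E (x - 1) (Suc y) + E x (Suc (Suc y)) + E x y = 0"
    and bottom: "\<And>x. E x 0 = 0"
    and "y < N"
  shows "E (x - 1) y + E x (Suc y) = (-1) ^ y * E (x + int y) 1"
proof -
  have "E (- (- x + 1)) y + E (- (- x)) (Suc y) = (-1) ^ y * E (- (- x - int y)) 1"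
  proof (rule wave_step_left[where E = "\<lambda>x. E (- x)" and N = N])
    fix x :: int and y assume "Suc y < N"
    moreover have "- x + 1 = - (x - 1)" "- x - 1 = - (x + 1)" by auto
    ultimately show "E (- (x + 1)) (Suc y) + E (- (x - 1)) (Suc y) + E (- x) (Suc (Suc y)) + E (- x) y = 0"
      using wave[of y "- x"] by (simp only: add_ac)
  qed (use bottom \<open>y < N\<close> in auto)
  then show ?thesis by (simp add: add.commute)
qed

lemma periodic_int_mult:
  fixes f :: "int \<Rightarrow> 'a" and p k x :: int
  assumes "\<And>x. f (x + p) = f x"
  shows "f (x + p * k) = f x"
proof (induction k rule: int_induct[where k = 0])
  case (step1 i)
  then show ?case using assms[of "x + p * i"] by (simp add: algebra_simps)
next
  case (step2 i)
  then show ?case using assms[of "x + p * (i - 1)"] by (simp add: algebra_simps)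
qed simp

lemma periodic_gcd:
  fixes f :: "int \<Rightarrow> 'a" and p q x :: int
  assumes "\<And>x. f (x + p) = f x" and "\<And>x. f (x + q) = f x"
  shows "f (x + gcd p q) = f x"
proof -
  obtain u v where "u * p + v * q = gcd p q"
    using bezout_int by blast
  then have "f (x + gcd p q) = f ((x + p * u) + q * v)"
    by (simp add: algebra_simps)
  also have "\<dots> = f x"
    using periodic_int_mult[of f q] periodic_int_mult[of f p] assms by metis
  finally show ?thesis .
qed

text \<open>Oddness and the period \<open>2 * d\<close> give only \<open>2 * f d = 0\<close>, which
  says nothing in characteristic 2. Instead \<open>f d\<close> equals \<open>f M\<close> or
  \<open>f N\<close>, because the coprime quotients of \<open>M\<close> and \<open>N\<close> by
  \<open>d\<close> are not both even.\<close>

lemma odd_periodic_eq_zero: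
  fixes f :: "int \<Rightarrow> 'k::field" and M N d :: int
  assumes "M > 0" "N > 0" and d: "d = gcd M N"
    and "\<And>x. f (x + 2 * M) = f x" "\<And>x. f (x + 2 * N) = f x"
    and odd: "\<And>x. f (- x) = - f x"
    and zeros: "f 0 = 0" "f M = 0" "f N = 0" "\<And>x. 0 < x \<Longrightarrow> x < d \<Longrightarrow> f x = 0"
  shows "f x = 0"
proof -
  have "d > 0" using \<open>M > 0\<close> d by simp
  have "gcd (2 * M) (2 * N) = 2 * d"
    unfolding d by (simp add: gcd_mult_distrib_int[symmetric])
  then have "f (x + 2 * d) = f x" for x
    using periodic_gcd[of f "2 * M" "2 * N" x] assms(4,5) by simp
  then have per: "f (x + 2 * d * k) = f x" for x k
    by (rule periodic_int_mult)
  have odd_mult: "f (d * k) = f d" if "odd k" for k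
  proof -
    obtain j where "k = 2 * j + 1" using \<open>odd k\<close> by (elim oddE)
    then show ?thesis using per[of d j] by (simp add: algebra_simps)
  qed
  obtain k l where kl: "M = d * k" "N = d * l" "coprime k l"
    using gcd_coprime_exists[of M N] \<open>d > 0\<close> d by (metis less_irrefl mult.commute)
  then have "odd k \<or> odd l"
    by (metis coprime_common_divisor odd_one)
  then have fd: "f d = 0"
    using odd_mult kl zeros by metis
  define r where "r = x mod (2 * d)"
  have r: "0 \<le> r" "r < 2 * d" using \<open>d > 0\<close> by (auto simp: r_def)
  have "f x = f r"
    using per[of r "x div (2 * d)"] by (simp add: r_def)
  also have "f r = 0"
  proof (cases "r \<le> d")
    case True
    then show ?thesis using zeros fd r by (cases "r = 0 \<or> r = d") auto
  next
    case False
    have "f r = f (- (2 * d - r))" using per[of "r" "-1"] by simp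
    also have "\<dots> = 0" unfolding odd using False r zeros(4)[of "2 * d - r"] by simp
    finally show ?thesis .
  qed
  finally show ?thesis .
qed

lemma wave_eq_zero:
  fixes E :: "int \<Rightarrow> nat \<Rightarrow> 'k::field"
  assumes "M > 0" "N > 0"
    and wave: "\<And>x y. Suc y < N \<Longrightarrow> E (x + 1) (Suc y) + E (x - 1) (Suc y) + E x (Suc (Suc y)) + E x y = 0"
    and bottom: "\<And>x. E x 0 = 0" and top: "\<And>x. E x N = 0"
    and left: "\<And>y. E 0 y = 0" and right: "\<And>y. E (int M) y = 0"
    and per: "\<And>x y. E (x + 2 * int M) y = E x y" and odd: "\<And>x y. E (- x) y = - E x y"
    and row: "\<And>x. 0 < x \<Longrightarrow> x < int (gcd M N) \<Longrightarrow> E x 1 = 0"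
    and "y \<le> N"
  shows "E x y = 0"
proof -
  have stepl: "E (x + 1) y + E x (Suc y) = (-1) ^ y * E (x - int y) 1" if "y < N" for x y
    using wave bottom that by (rule wave_step_left)
  have stepr: "E (x - 1) y + E x (Suc y) = (-1) ^ y * E (x + int y) 1" if "y < N" for x y
    using wave bottom that by (rule wave_step_right)
  obtain k where N: "N = Suc k" and "k < N"
    using \<open>N > 0\<close> by (cases N) auto
  have "E (x + 2 * int N) 1 = E x 1" for x
  proof -
    \<comment> \<open>As row \<open>N\<close> vanishes, the entry at \<open>(x + N, k)\<close> can
      be traced to row 1 along either diagonal, ending at \<open>x\<close> or at
      \<open>x + 2 * N\<close>.\<close>
    have "E (x + int N) k = (-1) ^ k * E x 1"
      using stepl[OF \<open>k < N\<close>, of "x + int k"] top by (simp add: N add_ac)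
    moreover have "E (x + int N) k = (-1) ^ k * E (x + 2 * int N) 1"
      using stepr[OF \<open>k < N\<close>, of "x + int k + 2"] top by (simp add: N algebra_simps)
    ultimately show ?thesis by simp
  qed
  \<comment> \<open>The diagonal from the left wall at \<open>(0, k)\<close> meets row 1 in column
    \<open>N\<close>.\<close>
  moreover have "E (int N) 1 = 0"
    using stepr[OF \<open>k < N\<close>, of 1] top left by (simp add: N)
  ultimately have row1: "E x 1 = 0" for x
    using odd_periodic_eq_zero[of "int M" "int N" "int (gcd M N)" "\<lambda>x. E x 1"] assms
    by simp
  show ?thesis
    using \<open>y \<le> N\<close>
  proof (induction y arbitrary: x)
    case (Suc y)
    then show ?case using stepl[of y x] row1 by simp
  qed (rule bottom)
qed

section \<open>Kernels of the adjacency maps\<close>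

text \<open>The flag \<open>b\<close> lets both kernels be treated at once: \<open>True\<close> is
  black, \<open>False\<close> is white.\<close>

definition colour_class :: "bool \<Rightarrow> nat \<Rightarrow> nat \<Rightarrow> (int \<times> int) set" where
  "colour_class b m n = {p \<in> rect_points m n. even (fst p + snd p) = b}"

definition neighbour_sum :: "(int \<times> int \<Rightarrow> 'k::field) \<Rightarrow> int \<Rightarrow> int \<Rightarrow> 'k" where
  "neighbour_sum v x y = v (x + 1, y) + v (x - 1, y) + v (x, y + 1) + v (x, y - 1)"

text \<open>Asking for the equation at points of both colours removes parity from the wave argument;
  at points of colour \<open>b\<close> it holds since all neighbours have the other colour.\<close>

definition colour_kernel :: "bool \<Rightarrow> nat \<Rightarrow> nat \<Rightarrow> (int \<times> int \<Rightarrow> 'k::field) set" where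
  "colour_kernel b m n =
     {v \<in> functions_on (colour_class b m n). \<forall>x y. (x, y) \<in> rect_points m n \<longrightarrow> neighbour_sum v x y = 0}"

lemma black_eq_colour_class: "black m n = colour_class True m n"
  and white_eq_colour_class: "white m n = colour_class False m n"
  by (auto simp: black_def white_def colour_class_def)

lemma sum_adjacent_eq_neighbour_sum:
  assumes "v \<in> functions_on S"
  shows "(\<Sum>q\<in>{q \<in> S. adjacent q (x, y)}. v q) = neighbour_sum v x y"
proof -
  let ?T = "{(x + 1, y), (x - 1, y), (x, y + 1), (x, y - 1)}"
  have "adjacent q (x, y) \<longleftrightarrow> q \<in> ?T" for q
    by (cases q) (auto simp: adjacent_def abs_if split: if_splits)
  then have "(\<Sum>q\<in>{q \<in> S. adjacent q (x, y)}. v q) = (\<Sum>q\<in>?T. v q)"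
    using assms by (intro sum.mono_neutral_left) (auto simp: functions_on_def)
  also have "\<dots> = neighbour_sum v x y"
    by (simp add: neighbour_sum_def add.assoc)
  finally show ?thesis .
qed

lemma neighbour_sum_same_colour:
  assumes "v \<in> functions_on (colour_class b m n)" "even (x + y) = b"
  shows "neighbour_sum v x y = 0"
  using assms by (auto simp: neighbour_sum_def functions_on_def colour_class_def)

lemma ker_BW_eq_colour_kernel:
  "ker_BW m n = (colour_kernel True m n :: (int \<times> int \<Rightarrow> 'k::field) set)"
proof -
  have "BW m n v = 0 \<longleftrightarrow> (\<forall>x y. (x, y) \<in> rect_points m n \<longrightarrow> neighbour_sum v x y = 0)"
    if v: "v \<in> functions_on (colour_class True m n)" for v :: "int \<times> int \<Rightarrow> 'k"
  proof -
    have "BW m n v = 0 \<longleftrightarrow> (\<forall>x y. (x, y) \<in> white m n \<longrightarrow> neighbour_sum v x y = 0)"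
      unfolding BW_def black_eq_colour_class fun_eq_iff
      using sum_adjacent_eq_neighbour_sum[OF v] by auto
    also have "\<dots> \<longleftrightarrow> (\<forall>x y. (x, y) \<in> rect_points m n \<longrightarrow> neighbour_sum v x y = 0)"
      using neighbour_sum_same_colour[OF v] by (auto simp: white_def)
    finally show ?thesis .
  qed
  then show ?thesis
    by (auto simp: ker_BW_def colour_kernel_def black_eq_colour_class)
qed

lemma ker_WB_eq_colour_kernel:
  "ker_WB m n = (colour_kernel False m n :: (int \<times> int \<Rightarrow> 'k::field) set)"
proof -
  have "WB m n v = 0 \<longleftrightarrow> (\<forall>x y. (x, y) \<in> rect_points m n \<longrightarrow> neighbour_sum v x y = 0)"
    if v: "v \<in> functions_on (colour_class False m n)" for v :: "int \<times> int \<Rightarrow> 'k"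
  proof -
    have "WB m n v = 0 \<longleftrightarrow> (\<forall>x y. (x, y) \<in> black m n \<longrightarrow> neighbour_sum v x y = 0)"
      unfolding WB_def white_eq_colour_class fun_eq_iff
      using sum_adjacent_eq_neighbour_sum[OF v] by auto
    also have "\<dots> \<longleftrightarrow> (\<forall>x y. (x, y) \<in> rect_points m n \<longrightarrow> neighbour_sum v x y = 0)"
      using neighbour_sum_same_colour[OF v] by (auto simp: black_def)
    finally show ?thesis .
  qed
  then show ?thesis
    by (auto simp: ker_WB_def colour_kernel_def white_eq_colour_class)
qed

lemma subspace_colour_kernel:
  "fun_vs.subspace (colour_kernel b m n :: (int \<times> int \<Rightarrow> 'k::field) set)"
proof -
  have "neighbour_sum 0 x y = 0"
    "neighbour_sum (u + v) x y = neighbour_sum u x y + neighbour_sum v x y"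
    "neighbour_sum (fun_scale a v) x y = a * neighbour_sum v x y"
    for u v :: "int \<times> int \<Rightarrow> 'k" and a x y
    by (simp_all add: neighbour_sum_def fun_scale_def algebra_simps)
  moreover have "fun_vs.subspace (functions_on (colour_class b m n) :: (int \<times> int \<Rightarrow> 'k) set)"
    by (rule subspace_functions_on)
  ultimately show ?thesis
    unfolding fun_vs.subspace_def colour_kernel_def by auto
qed

lemma colour_kernel_outside:
  assumes "v \<in> colour_kernel b m n" "x < 0 \<or> x \<ge> int m \<or> y < 0 \<or> y \<ge> int n"
  shows "v (x, y) = 0"
  using assms by (auto simp: colour_kernel_def functions_on_def colour_class_def rect_points_def)

text \<open>The odd periodic extension of \<open>v\<close> meets the conditions of
  \<open>wave_eq_zero\<close>. The bound on \<open>t\<close> is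
  \<open>x < gcd (m + 1) (n + 1)\<close> for the shifted column \<open>x = t + 1\<close>.\<close>

lemma colour_kernel_eq_zero:
  fixes v :: "int \<times> int \<Rightarrow> 'k::field"
  assumes v: "v \<in> colour_kernel b m n"
    and row: "\<And>t. t + 2 \<le> gcd (m + 1) (n + 1) \<Longrightarrow> v (int t, 0) = 0"
  shows "v = 0"
proof
  define M where "M = m + 1"
  note out = colour_kernel_outside[OF v]
  \<comment> \<open>\<open>P\<close> repeats \<open>v\<close> with period \<open>2 * M\<close>,
    shifted so that the frame is columns 0 and \<open>M\<close>, rows 0 and \<open>n + 1\<close>;
    columns from \<open>M\<close> to \<open>2 * M\<close> are zero. \<open>E\<close> is the odd part
    without the factor 1/2, which keeps characteristic 2 included.\<close>
  define P where "P x y = v (x mod (2 * int M) - 1, int y - 1)" for x y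
  define E where "E x y = P x y - P (- x) y" for x y
  have P_near: "P (x + 1) y = v (x mod (2 * int M), int y - 1)"
    "x mod (2 * int M) > 0 \<Longrightarrow> P (x - 1) y = v (x mod (2 * int M) - 2, int y - 1)" for x y
  proof -
    let ?r = "x mod (2 * int M)"
    have r: "0 \<le> ?r" "?r < 2 * int M" by (auto simp: M_def)
    have "(x + 1) mod (2 * int M) = (?r + 1) mod (2 * int M)" by (simp add: mod_add_left_eq)
    also have "\<dots> = (if ?r + 1 = 2 * int M then 0 else ?r + 1)" using r by simp
    finally show "P (x + 1) y = v (?r, int y - 1)"
      using out[of "-1"] out[of ?r] by (auto simp: P_def M_def)
    show "P (x - 1) y = v (?r - 2, int y - 1)" if "?r > 0"
    proof -
      have "(x - 1) mod (2 * int M) = (?r - 1) mod (2 * int M)" by (simp add: mod_diff_left_eq)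
      also have "\<dots> = ?r - 1" using r that by simp
      finally show ?thesis by (simp add: P_def)
    qed
  qed
  define L where "L x y = P (x + 1) (Suc y) + P (x - 1) (Suc y) + P x (Suc (Suc y)) + P x y" for x y
  \<comment> \<open>Columns 0 and \<open>M\<close> see \<open>v\<close> on one side only, so the
    equation for \<open>P\<close> may fail there. Elsewhere it is the kernel equation or a sum of
    zeros.\<close>
  have L_inner: "L x y = 0" if "Suc y < n + 1" "x mod (2 * int M) \<noteq> 0" "x mod (2 * int M) \<noteq> int M" for x y
  proof -
    let ?r = "x mod (2 * int M)"
    have "0 \<le> ?r" by (simp add: M_def)
    then have r: "0 < ?r" using that(2) by linarith
    have "L x y = neighbour_sum v (?r - 1) (int y)"
      using P_near[of x "Suc y"] r by (simp add: L_def P_def neighbour_sum_def add.commute)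
    also have "\<dots> = 0"
    proof (cases "?r < int M")
      case True
      then have "(?r - 1, int y) \<in> rect_points m n"
        using r that(1) by (auto simp: rect_points_def M_def)
      then show ?thesis using v by (auto simp: colour_kernel_def)
    next
      case False
      then show ?thesis
        using that(3) out by (simp add: neighbour_sum_def M_def)
    qed
    finally show ?thesis .
  qed
  have mirror: "- x mod (2 * int M) = x mod (2 * int M)"
    if "x mod (2 * int M) = 0 \<or> x mod (2 * int M) = int M" for x
    using that by (auto simp: zmod_zminus1_eq_if M_def)
  have P_cong: "P x y = P x' y" if "x mod (2 * int M) = x' mod (2 * int M)" for x x' y
    using that by (simp add: P_def)
  \<comment> \<open>Reflection modulo \<open>2 * M\<close> fixes columns 0 and \<open>M\<close>, so
    the defect of \<open>P\<close> there is symmetric and cancels in \<open>E\<close>.\<close>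
  have L_odd: "L x y = L (- x) y" if "Suc y < n + 1" for x y
  proof (cases "x mod (2 * int M) = 0 \<or> x mod (2 * int M) = int M")
    case True
    note eq = mirror[OF True]
    have "(- x + 1) mod (2 * int M) = (x + 1) mod (2 * int M)"
      "(- x - 1) mod (2 * int M) = (x - 1) mod (2 * int M)"
      by (metis eq mod_add_left_eq) (metis eq mod_diff_left_eq)
    then show ?thesis
      unfolding L_def using eq P_cong by metis
  next
    case False
    then have "- x mod (2 * int M) \<noteq> 0 \<and> - x mod (2 * int M) \<noteq> int M"
      using mirror[of "- x"] by auto
    then show ?thesis using False L_inner that by simp
  qed
  have E0: "E x y = 0" if "y \<le> n + 1" for x y
  proof (rule wave_eq_zero[where M = M and N = "n + 1"])
    fix x :: int and y assume "Suc y < n + 1"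
    moreover have "- (x + 1) = - x - 1" "- (x - 1) = - x + 1" by auto
    ultimately show "E (x + 1) (Suc y) + E (x - 1) (Suc y) + E x (Suc (Suc y)) + E x y = 0"
      using L_odd[of y x] unfolding E_def L_def by (simp only:) (simp add: algebra_simps)
  next
    fix x assume x: "0 < x" "x < int (gcd M (n + 1))"
    have "gcd M (n + 1) \<le> M" by (intro gcd_le1_nat) (simp add: M_def)
    then have "x < int M" using x by linarith
    then have "x mod (2 * int M) = x" "- x mod (2 * int M) = 2 * int M - x"
      using x by (auto simp: zmod_zminus1_eq_if)
    moreover have "v (x - 1, 0) = 0"
      using row[of "nat (x - 1)"] x by (simp add: M_def)
    moreover have "v (2 * int M - x - 1, 0) = 0"
      using out \<open>x < int M\<close> by (simp add: M_def)
    ultimately show "E x 1 = 0"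
      by (simp add: E_def P_def)
  next
    show "E (int M) y = 0" for y
      using mirror[of "int M"] by (simp add: E_def P_def M_def)
    show "E (x + 2 * int M) y = E x y" for x y
    proof -
      have "(- x - 2 * int M) mod (2 * int M) = - x mod (2 * int M)"
        by (metis minus_mod_self2)
      then show ?thesis by (simp add: E_def P_def)
    qed
  qed (use that out in \<open>auto simp: E_def P_def M_def\<close>)
  fix p :: "int \<times> int"
  obtain x y where p: "p = (x, y)" by force
  show "v p = 0 p"
  proof (cases "p \<in> rect_points m n")
    case True
    then have xy: "0 \<le> x" "x < int m" "0 \<le> y" "y < int n" by (auto simp: p rect_points_def)
    \<comment> \<open>The mirror image of column \<open>x + 1\<close> lies in the zero half of the
      period, so \<open>E\<close> at the shifted point is \<open>v (x, y)\<close> itself.\<close>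
    have "- (x + 1) mod (2 * int M) = (- (x + 1) + 2 * int M) mod (2 * int M)"
      by (simp only: mod_add_self2)
    also have "\<dots> = 2 * int M - (x + 1)"
      using xy by (subst mod_pos_pos_trivial) (auto simp: M_def)
    finally have "- (x + 1) mod (2 * int M) = 2 * int M - (x + 1)" .
    moreover have "(x + 1) mod (2 * int M) = x + 1"
      using xy by (simp add: M_def)
    ultimately have "E (x + 1) (nat (y + 1)) = v (x, y) - v (2 * int M - (x + 1) - 1, y)"
      using xy unfolding E_def P_def by (simp only:) simp
    also have "v (2 * int M - (x + 1) - 1, y) = 0"
      using out xy by (simp add: M_def)
    finally show ?thesis
      using E0[of "nat (y + 1)" "x + 1"] xy p by simp
  next
    case False
    then show ?thesis using out[of x y] by (auto simp: p rect_points_def)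
  qed
qed

section \<open>The basis\<close>

text \<open>The disjunction, in place of a sum of two indicators, gives the value 1 also for
  \<open>a = d\<close>, where the two classes coincide and the sum would be 2.\<close>

definition reflect_ind :: "nat \<Rightarrow> nat \<Rightarrow> int \<Rightarrow> 'k::field" where
  "reflect_ind d a t = of_bool ([t = int a] (mod 2 * int d) \<or> [t = - int a] (mod 2 * int d))"

text \<open>With the origin as a corner, the points of the introduction are \<open>(x + 1, y + 1)\<close>.\<close>

definition billiard :: "nat \<Rightarrow> nat \<Rightarrow> nat \<Rightarrow> nat \<Rightarrow> int \<times> int \<Rightarrow> 'k::field" where
  "billiard m n d a = (\<lambda>(x, y). if (x, y) \<in> rect_points m n
     then (-1) ^ nat (y + 1) * (reflect_ind d a (x + y + 2) - reflect_ind d a (x - y)) else 0)"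

lemma reflect_ind_minus: "reflect_ind d a (- t) = reflect_ind d a t"
proof -
  have "[- t = s] (mod q) \<longleftrightarrow> [t = - s] (mod q)" for s q :: int
    by (metis cong_minus_minus_iff minus_minus)
  then show ?thesis by (auto simp: reflect_ind_def)
qed

lemma reflect_ind_periodic: "reflect_ind d a (t + 2 * int d * k) = reflect_ind d a t"
  by (simp add: reflect_ind_def cong_def)

lemma reflect_ind_parity:
  assumes "reflect_ind d a t \<noteq> (0::'k::field)"
  shows "even t \<longleftrightarrow> even a"
proof -
  have "[t = int a] (mod 2 * int d) \<or> [t = - int a] (mod 2 * int d)"
    using assms by (auto simp: reflect_ind_def)
  then have "2 * int d dvd t - int a \<or> 2 * int d dvd t + int a"
    by (simp add: cong_iff_dvd_diff)
  then have "even (t - int a) \<or> even (t + int a)"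
    using dvd_mult_left by blast
  then show ?thesis by auto
qed

text \<open>The interval from 0 to \<open>d\<close> is a fundamental domain for the group generated
  by negation and translation by \<open>2 * d\<close>.\<close>

lemma reflect_ind_fundamental:
  assumes "a \<le> d" "s \<le> d"
  shows "reflect_ind d a (int s) = (of_bool (s = a) :: 'k::field)"
proof -
  have "s = a" if "[int s = int a] (mod 2 * int d)"
  proof -
    have "2 * int d dvd int s - int a" using that by (simp add: cong_iff_dvd_diff)
    then show ?thesis using assms dvd_imp_le_int[of "int s - int a" "2 * int d"]
      by linarith
  qed
  moreover have "s = a" if "[int s = - int a] (mod 2 * int d)"
  proof -
    have dvd: "2 * int d dvd int s + int a" using that by (simp add: cong_iff_dvd_diff)
    then have "int s + int a = 0 \<or> int s + int a \<ge> 2 * int d"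
      using zdvd_imp_le[OF dvd] by linarith
    then show ?thesis using assms by linarith
  qed
  ultimately show ?thesis by (auto simp: reflect_ind_def)
qed

lemma billiard_values: "billiard m n d a p \<in> {0, 1, -1::'k::field}"
proof -
  obtain x y where p: "p = (x, y)" by force
  have "(-1::'k) ^ nat (y + 1) = 1 \<or> (-1::'k) ^ nat (y + 1) = -1"
    by (cases "even (nat (y + 1))") auto
  then show ?thesis
    by (auto simp: p billiard_def reflect_ind_def)
qed

lemma billiard_row:
  assumes "d \<le> m + 1" "n > 0" "a \<le> d" "t + 2 \<le> d"
  shows "billiard m n d a (int t, 0) = (of_bool (t = a) - of_bool (t + 2 = a) :: 'k::field)"
proof -
  have "(int t, 0) \<in> rect_points m n" using assms by (auto simp: rect_points_def)
  moreover have "reflect_ind d a (int t) = (of_bool (t = a) :: 'k)"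
    using assms by (intro reflect_ind_fundamental) auto
  moreover have "reflect_ind d a (int t + 2) = (of_bool (t + 2 = a) :: 'k)"
    using reflect_ind_fundamental[of a d "t + 2", where 'k = 'k] assms by (simp add: add.commute)
  ultimately show ?thesis by (simp add: billiard_def)
qed

text \<open>The untruncated formula \<open>?G\<close> solves the equation at every point of the
  rectangle and vanishes on the surrounding frame, so it may be cut off there.\<close>

lemma billiard_in_colour_kernel:
  assumes "d dvd m + 1" "d dvd n + 1"
  shows "billiard m n d a \<in> (colour_kernel (even a) m n :: (int \<times> int \<Rightarrow> 'k::field) set)"
proof -
  let ?F = "reflect_ind d a :: int \<Rightarrow> 'k"
  let ?G = "\<lambda>(x, y). (-1) ^ nat (y + 1) * (?F (x + y + 2) - ?F (x - y))"
  have supp: "(billiard m n d a :: int \<times> int \<Rightarrow> 'k) \<in> functions_on (colour_class (even a) m n)"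
  proof -
    have "billiard m n d a (x, y) = (0 :: 'k)" if "(x, y) \<notin> colour_class (even a) m n" for x y
    proof (cases "(x, y) \<in> rect_points m n")
      case True
      then have "even (x + y) \<noteq> even a" using that by (auto simp: colour_class_def)
      then have "?F (x + y + 2) = 0" "?F (x - y) = 0"
        using reflect_ind_parity[of d a "x + y + 2", where 'k = 'k]
          reflect_ind_parity[of d a "x - y", where 'k = 'k] by auto
      then show ?thesis by (simp add: billiard_def)
    qed (simp add: billiard_def)
    then show ?thesis by (auto simp: functions_on_def)
  qed
  obtain k l where kl: "m + 1 = d * k" "n + 1 = d * l" using assms by (auto elim!: dvdE)
  have shift: "?F s = ?F t" if "s = t + 2 * int (m + 1) \<or> s = t + 2 * int (n + 1)" for s t
    using that reflect_ind_periodic[of d a t "int k"] reflect_ind_periodic[of d a t "int l"]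
    unfolding kl by (auto simp: algebra_simps)
  have flip: "?F s = ?F t" if "s = - t" for s t
    using that by (simp add: reflect_ind_minus)
  have eq: "billiard m n d a (x, y) = ?G (x, y)"
    if "-1 \<le> x" "x \<le> int m" "-1 \<le> y" "y \<le> int n" for x y
  proof (cases "(x, y) \<in> rect_points m n")
    case True
    then show ?thesis by (simp add: billiard_def)
  next
    case False
    then have "x = -1 \<or> x = int m \<or> y = -1 \<or> y = int n"
      using that by (simp add: rect_points_def) arith
    then consider "x = -1" | "x = int m" | "y = -1" | "y = int n" by blast
    \<comment> \<open>On the left side the two arguments are opposite, on the lower side equal; on
      the other two they agree up to sign and a shift by \<open>2 * (m + 1)\<close> or
      \<open>2 * (n + 1)\<close>, both multiples of \<open>2 * d\<close>.\<close>
    then have "?F (x + y + 2) = ?F (x - y)"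
    proof cases
      case 1 then show ?thesis by (intro flip) simp
    next
      case 2
      have "?F (x + y + 2) = ?F (y - x)" using 2 by (intro shift) simp
      also have "\<dots> = ?F (x - y)" by (intro flip) simp
      finally show ?thesis .
    next
      case 3 then show ?thesis by (simp add: add.commute)
    next
      case 4 then show ?thesis by (intro shift) simp
    qed
    then show ?thesis using False by (simp add: billiard_def)
  qed
  have "neighbour_sum (billiard m n d a) x y = (0::'k)" if "(x, y) \<in> rect_points m n" for x y
  proof -
    have xy: "0 \<le> x" "x < int m" "0 \<le> y" "y < int n"
      using that by (auto simp: rect_points_def)
    define j where "j = nat y"
    have "nat (y + 1) = Suc j" "nat (y + 1 + 1) = Suc (Suc j)" "nat (y - 1 + 1) = j"
      using xy by (auto simp: j_def)
    \<comment> \<open>Horizontal and vertical neighbours carry opposite signs, so the values of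
      \<open>?F\<close> at \<open>x + y + 3\<close>, \<open>x + y + 1\<close>,
      \<open>x - y + 1\<close> and \<open>x - y - 1\<close> each cancel.\<close>
    then show ?thesis
      using xy by (simp add: neighbour_sum_def eq) (simp add: algebra_simps)
  qed
  with supp show ?thesis by (auto simp: colour_kernel_def)
qed

text \<open>
  The values \<open>a = 0\<close> and \<open>a = 1\<close> are left out because an indicator function of a parity class
  contributes nothing.
\<close>

definition basis_indices :: "bool \<Rightarrow> nat \<Rightarrow> nat set" where
  "basis_indices b d = {a \<in> {2..d}. even a = b}"

lemma card_basis_indices:
  "card (basis_indices True d) = d div 2"
  "card (basis_indices False d) = (d - 1) div 2"
proof -
  have "basis_indices True d = (\<lambda>i. 2 * i) ` {1..d div 2}"
    by (auto simp: basis_indices_def elim!: evenE)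
  then show "card (basis_indices True d) = d div 2"
    by (simp add: card_image inj_on_def)
  have "basis_indices False d = (\<lambda>i. 2 * i + 1) ` {1..(d - 1) div 2}"
    by (auto simp: basis_indices_def elim!: oddE)
  then show "card (basis_indices False d) = (d - 1) div 2"
    by (simp add: card_image inj_on_def)
qed

section \<open>Coordinates from the bottom row\<close>

lemma fun_sum_apply: "(\<Sum>a\<in>A. g a) p = (\<Sum>a\<in>A. g a p :: 'k::field)"
  by (induction A rule: infinite_finite_induct) auto

text \<open>Setting \<open>c\<close> to zero at the remaining indices up to \<open>d\<close>, among
  them 0 and 1, turns the start of the bottom row into a difference with step two.\<close>

lemma billiard_sum_row:
  fixes c :: "nat \<Rightarrow> 'k::field"
  assumes "d \<le> m + 1" "n > 0" "t + 2 \<le> d" "\<And>a. a \<notin> basis_indices b d \<Longrightarrow> a \<le> d \<Longrightarrow> c a = 0"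
  shows "(\<Sum>a\<in>basis_indices b d. fun_scale (c a) (billiard m n d a)) (int t, 0) = c t - c (t + 2)"
proof -
  have fin: "finite (basis_indices b d)" by (simp add: basis_indices_def)
  have pick: "(\<Sum>a\<in>basis_indices b d. c a * of_bool (s = a)) = c s" if "s \<le> d" for s
    using fin assms(4)[of s] that by (simp add: of_bool_def if_distrib cong: if_cong)
  have "(\<Sum>a\<in>basis_indices b d. fun_scale (c a) (billiard m n d a)) (int t, 0)
      = (\<Sum>a\<in>basis_indices b d. c a * of_bool (t = a) - c a * of_bool (t + 2 = a))"
    unfolding fun_sum_apply
    using assms by (intro sum.cong) (auto simp: fun_scale_def billiard_row basis_indices_def algebra_simps)
  also have "\<dots> = c t - c (t + 2)"
    unfolding sum_subtractf using pick assms(3) by simp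
  finally show ?thesis .
qed

lemma two_step_zero:
  fixes c :: "nat \<Rightarrow> 'k::field"
  assumes "c 0 = 0" "c 1 = 0" "\<And>t. t + 2 \<le> d \<Longrightarrow> c (t + 2) = c t" "a \<le> d"
  shows "c a = 0"
  using \<open>a \<le> d\<close>
proof (induction a rule: less_induct)
  case (less a)
  consider "a = 0" | "a = 1" | t where "a = t + 2"
    by (metis One_nat_def add_2_eq_Suc' not0_implies_Suc)
  then show ?case using assms(1-3) less by cases auto
qed

lemma inj_on_billiard:
  assumes "d \<le> m + 1" "n > 0"
  shows "inj_on (billiard m n d :: nat \<Rightarrow> int \<times> int \<Rightarrow> 'k::field) (basis_indices b d)"
proof (rule linorder_inj_onI)
  fix a a' assume "a < a'" "a \<in> basis_indices b d" "a' \<in> basis_indices b d"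
  \<comment> \<open>At position \<open>a - 2\<close> of the bottom row, index \<open>a\<close> gives
    -1 and the larger index \<open>a'\<close> gives 0.\<close>
  then have "billiard m n d a (int (a - 2), 0) \<noteq> (billiard m n d a' (int (a - 2), 0) :: 'k)"
    using assms by (subst (1 2) billiard_row) (auto simp: basis_indices_def)
  then show "billiard m n d a \<noteq> (billiard m n d a' :: int \<times> int \<Rightarrow> 'k)" by metis
qed auto

text \<open>A vanishing combination has a vanishing bottom row, so \<open>c (t + 2) = c t\<close>,
  starting from \<open>c 0 = c 1 = 0\<close>.\<close>

lemma independent_billiard:
  assumes "d \<le> m + 1" "n > 0"
  shows "fun_vs.independent
    ((billiard m n d :: nat \<Rightarrow> int \<times> int \<Rightarrow> 'k::field) ` basis_indices b d)"
proof (rule fun_vs.independent_if_scalars_zero)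
  let ?g = "billiard m n d :: nat \<Rightarrow> int \<times> int \<Rightarrow> 'k"
  show "finite (?g ` basis_indices b d)" by (simp add: basis_indices_def)
  fix u x assume sum0: "(\<Sum>x\<in>?g ` basis_indices b d. fun_scale (u x) x) = 0"
    and "x \<in> ?g ` basis_indices b d"
  then obtain a where a: "a \<in> basis_indices b d" "x = ?g a" by blast
  define c where "c a = (if a \<in> basis_indices b d then u (?g a) else 0)" for a
  have "(\<Sum>a\<in>basis_indices b d. fun_scale (c a) (?g a)) = 0"
    using sum0 by (simp add: sum.reindex[OF inj_on_billiard[OF assms]] c_def)
  then have step: "c (t + 2) = c t" if "t + 2 \<le> d" for t
    using billiard_sum_row[OF assms that, of b c] by (simp add: c_def)
  have "c a = 0"
    using a by (intro two_step_zero[where d = d and c = c and a = a] step)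
      (auto simp: c_def basis_indices_def)
  then show "u x = 0" using a by (simp add: c_def)
qed

text \<open>This inverts the step-two difference: \<open>c = row_potential r\<close> solves
  \<open>c t - c (t + 2) = r t\<close> with \<open>c 0 = c 1 = 0\<close>.\<close>

fun row_potential :: "(nat \<Rightarrow> 'k::field) \<Rightarrow> nat \<Rightarrow> 'k" where
  "row_potential r 0 = 0"
| "row_potential r (Suc 0) = 0"
| "row_potential r (Suc (Suc t)) = row_potential r t - r t"

lemma row_potential_parity:
  assumes "\<And>t. even t \<noteq> b \<Longrightarrow> r t = 0" "even a \<noteq> b"
  shows "row_potential r a = 0"
  using assms(2)
proof (induction a rule: induct_nat_012)
  case (ge2 t)
  then show ?case using assms(1)[of t] by simp
qed simp_all

text \<open>Subtracting the combination with the same start of the bottom row leaves a kernel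
  element that is zero by uniqueness.\<close>

lemma span_billiard:
  fixes m n :: nat
  assumes d: "d = gcd (m + 1) (n + 1)" and "n > 0"
  shows "fun_vs.span (billiard m n d ` basis_indices b d)
    = (colour_kernel b m n :: (int \<times> int \<Rightarrow> 'k::field) set)"
proof
  let ?g = "billiard m n d :: nat \<Rightarrow> int \<times> int \<Rightarrow> 'k"
  have "d \<le> m + 1" unfolding d by (intro gcd_le1_nat) simp
  have g: "?g a \<in> colour_kernel b m n" if "a \<in> basis_indices b d" for a
    using billiard_in_colour_kernel[of d m n a] that by (auto simp: d basis_indices_def)
  then show "fun_vs.span (?g ` basis_indices b d) \<subseteq> colour_kernel b m n"
    by (intro fun_vs.span_minimal subspace_colour_kernel) auto
  show "colour_kernel b m n \<subseteq> fun_vs.span (?g ` basis_indices b d)"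
  proof
    fix v :: "int \<times> int \<Rightarrow> 'k" assume v: "v \<in> colour_kernel b m n"
    define c where "c = row_potential (\<lambda>t. v (int t, 0))"
    have c_out: "c a = 0" if "a \<notin> basis_indices b d" "a \<le> d" for a
    proof (cases "even a = b")
      case True
      then have "a = 0 \<or> a = 1" using that by (auto simp: basis_indices_def)
      then show ?thesis by (auto simp: c_def)
    next
      case False
      have "v (int t, 0) = 0" if "even t \<noteq> b" for t
        using v that by (auto simp: colour_kernel_def functions_on_def colour_class_def)
      then show ?thesis unfolding c_def using False by (rule row_potential_parity)
    qed
    define w where "w = (\<Sum>a\<in>basis_indices b d. fun_scale (c a) (?g a))"
    have "w \<in> colour_kernel b m n"
      unfolding w_def
      using g by (intro fun_vs.subspace_sum fun_vs.subspace_scale subspace_colour_kernel)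
    then have "v - w \<in> colour_kernel b m n"
      using v by (intro fun_vs.subspace_diff subspace_colour_kernel)
    moreover have "(v - w) (int t, 0) = 0" if "t + 2 \<le> gcd (m + 1) (n + 1)" for t
      using billiard_sum_row[OF \<open>d \<le> m + 1\<close> \<open>n > 0\<close>, of t b c] c_out that
      by (simp add: w_def d c_def)
    ultimately have "v - w = 0" by (rule colour_kernel_eq_zero)
    then have "v = w" by simp
    also have "w \<in> fun_vs.span (?g ` basis_indices b d)"
      unfolding w_def by (intro fun_vs.span_sum fun_vs.span_scale fun_vs.span_base) auto
    finally show "v \<in> fun_vs.span (?g ` basis_indices b d)" .
  qed
qed

theorem theorem1:
  fixes m n c :: nat
  assumes "m > 0" and "n > 0"
    and "c = gcd (m + 1) (n + 1) - 1"
  shows "int (fun_vs.dim (ker_BW m n :: (int \<times> int \<Rightarrow> 'k::field) set)) = \<lceil>real c / 2\<rceil>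
    \<and> int (fun_vs.dim (ker_WB m n :: (int \<times> int \<Rightarrow> 'k) set)) = \<lfloor>real c / 2\<rfloor>
    \<and> (\<exists>B :: (int \<times> int \<Rightarrow> 'k) set.
         fun_vs.independent B \<and> fun_vs.span B = ker_BW m n
         \<and> (\<forall>v\<in>B. \<forall>p\<in>black m n. v p \<in> {0, 1, -1}))
    \<and> (\<exists>B :: (int \<times> int \<Rightarrow> 'k) set.
         fun_vs.independent B \<and> fun_vs.span B = ker_WB m n
         \<and> (\<forall>v\<in>B. \<forall>p\<in>white m n. v p \<in> {0, 1, -1}))"
proof -
  define d where "d = gcd (m + 1) (n + 1)"
  have d: "d \<le> m + 1" "d > 0" unfolding d_def by (auto intro: gcd_le1_nat)
  have "d = c + 1" using assms(3) d(2) by (simp add: d_def)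
  define B where "B b = (billiard m n d :: nat \<Rightarrow> int \<times> int \<Rightarrow> 'k) ` basis_indices b d" for b
  have indep: "fun_vs.independent (B b)" for b
    unfolding B_def by (rule independent_billiard[OF d(1) \<open>n > 0\<close>])
  have span: "fun_vs.span (B b) = colour_kernel b m n" for b
    unfolding B_def by (rule span_billiard[OF d_def \<open>n > 0\<close>])
  have vals: "v p \<in> {0, 1, -1}" if "v \<in> B b" for v b p
    using that billiard_values unfolding B_def by blast
  have dim: "fun_vs.dim (colour_kernel b m n :: (int \<times> int \<Rightarrow> 'k) set) = card (basis_indices b d)" for b
    using fun_vs.dim_span_eq_card_independent[OF indep[of b]]
      card_image[OF inj_on_billiard[OF d(1) \<open>n > 0\<close>]]
    by (simp add: span) (simp add: B_def)
  \<comment> \<open>As \<open>d = c + 1\<close>, these are the cardinalities \<open>d div 2\<close>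
    and \<open>(d - 1) div 2\<close> of the two index sets.\<close>
  have "\<lceil>real c / 2\<rceil> = int ((c + 1) div 2)"
    by (cases "even c") (auto elim!: evenE oddE simp: ceiling_eq_iff)
  moreover have "\<lfloor>real c / 2\<rfloor> = int (c div 2)"
    using floor_divide_of_nat_eq[of c 2, where 'a = real] by simp
  ultimately show ?thesis
    unfolding ker_BW_eq_colour_kernel ker_WB_eq_colour_kernel dim card_basis_indices \<open>d = c + 1\<close>
    using indep span vals by (intro conjI exI[where x = "B True"] exI[where x = "B False"]) auto
qed

end
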